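(* Let $(W,S)$ and $(W',S')$ be Coxeter systems, let $(X,\mathrm{ht})$ be a quasiparabolic $W\times W'$-set, and let $H\subset W'$ be a quasiparabolic subgroup such that on every $H$-orbit in $X$ the height is bounded from below. Let $X/H$ be the $W$-set of $H$-orbits in $X$, and define $\mathrm{ht}'(Hx)=\min_{y\in Hx}\{\mathrm{ht}(y)\}$. Then $(X/H,\mathrm{ht}')$ is a quasiparabolic $W$-set.
   Context: Coxeter systems $(W,S)$ have finite rank; $R(W)$ is the set of reflections, i.e. conjugates in $W$ of elements of $S$; $\ell$ is the length function. A product $W\times W'$ of Coxeter groups is a Coxeter group with simple reflections $S\sqcup S'$. A scaled $W$-set is a pair $(X,\mathrm{ht})$ with $X$ a (left) $W$-set and $\mathrm{ht}:X\to\mathbb Z$ a function with $|\mathrm{ht}(sx)-\mathrm{ht}(x)|\le 1$ for all $s\in S$, $x\in X$. A quasiparabolic $W$-set is a scaled $W$-set such that (QP1) for all $r\in R(W)$, $x\in X$, if $\mathrm{ht}(rx)=\mathrm{ht}(x)$ then $rx=x$; and (QP2) for all $r\in R(W)$, $x\in X$, $s\in S$, if $\mathrm{ht}(rx)>\mathrm{ht}(x)$ and $\mathrm{ht}(srx)<\mathrm{ht}(sx)$, then $rx=sx$. A subgroup $H\subset W$ is quasiparabolic if the set of left cosets $W/H$ with height $\mathrm{ht}(wH)=\min_{v\in wH}\ell(v)$ is a quasiparabolic $W$-set. *)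

theory Defs
  imports "HOL-Algebra.Group_Action" "HOL-Algebra.Left_Coset" "HOL-Algebra.Generated_Groups"
    "HOL-Algebra.Multiplicative_Group"
begin

section \<open>Coxeter systems\<close>

definition word_prod :: "('a, 'b) monoid_scheme \<Rightarrow> 'a list \<Rightarrow> 'a"
  where "word_prod G ws = foldr (\<lambda>x y. x \<otimes>\<^bsub>G\<^esub> y) ws \<one>\<^bsub>G\<^esub>"

text \<open>
  The congruence on words over \<open>S\<close> generated by the Coxeter relations \<open>(st)\<^sup>m = 1\<close>, where \<open>m\<close> is
  the order of \<open>st\<close>. As \<^const>\<open>group.ord\<close> is \<open>0\<close> on elements of infinite order, such pairs
  contribute only the empty relator. For involutions, \<open>s = t\<close> gives the relation \<open>s s = 1\<close>; every
  letter is then its own inverse, so no formal inverses are needed: words modulo this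
  congruence form the group presented by the Coxeter relations.
\<close>

inductive coxeter_congruence ::
  "('a, 'b) monoid_scheme \<Rightarrow> 'a set \<Rightarrow> 'a list \<Rightarrow> 'a list \<Rightarrow> bool"
  for G S
  where
    relator: "\<lbrakk> set u \<subseteq> S; set v \<subseteq> S; s \<in> S; t \<in> S \<rbrakk> \<Longrightarrow>
      coxeter_congruence G S (u @ concat (replicate (group.ord G (s \<otimes>\<^bsub>G\<^esub> t)) [s, t]) @ v) (u @ v)"
  | refl: "set u \<subseteq> S \<Longrightarrow> coxeter_congruence G S u u"
  | sym: "coxeter_congruence G S u v \<Longrightarrow> coxeter_congruence G S v u"
  | trans: "\<lbrakk> coxeter_congruence G S u v; coxeter_congruence G S v w \<rbrakk> \<Longrightarrow>
      coxeter_congruence G S u w"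

text \<open>
  The last assumption says that the Coxeter relations are defining relations; the converse
  implication holds automatically.
\<close>

locale coxeter_system = group G for G (structure) +
  fixes S :: "'a set"
  assumes finite_rank: "finite S"
    and simple_subset: "S \<subseteq> carrier G"
    and simple_order: "\<And>s. s \<in> S \<Longrightarrow> ord s = 2"
    and generates: "generate G S = carrier G"
    and presentation: "\<And>u v. \<lbrakk> set u \<subseteq> S; set v \<subseteq> S; word_prod G u = word_prod G v \<rbrakk> \<Longrightarrow>
      coxeter_congruence G S u v"

definition coxeter_length :: "('a, 'b) monoid_scheme \<Rightarrow> 'a set \<Rightarrow> 'a \<Rightarrow> nat"
  where "coxeter_length G S w = (LEAST n. \<exists>ws. set ws \<subseteq> S \<and> word_prod G ws = w \<and> length ws = n)"

definition reflections :: "('a, 'b) monoid_scheme \<Rightarrow> 'a set \<Rightarrow> 'a set"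
  where "reflections G S = {w \<otimes>\<^bsub>G\<^esub> s \<otimes>\<^bsub>G\<^esub> inv\<^bsub>G\<^esub> w | w s. w \<in> carrier G \<and> s \<in> S}"

definition prod_simple ::
  "('a, 'c) monoid_scheme \<Rightarrow> 'a set \<Rightarrow> ('b, 'd) monoid_scheme \<Rightarrow> 'b set \<Rightarrow> ('a \<times> 'b) set"
  where "prod_simple W S W' S' = S \<times> {\<one>\<^bsub>W'\<^esub>} \<union> {\<one>\<^bsub>W\<^esub>} \<times> S'"


section \<open>Quasiparabolic sets and subgroups\<close>

text \<open>
  In the next two locales, \<open>S\<close> is meant to be the set of simple reflections of a Coxeter
  system with group \<open>G\<close>; this is not part of the locale assumptions.
\<close>

locale scaled_set = group_action G X \<phi> for G (structure) and X and \<phi> +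
  fixes S :: "'a set" and ht :: "'b \<Rightarrow> int"
  assumes ht_simple: "\<And>s x. \<lbrakk> s \<in> S; x \<in> X \<rbrakk> \<Longrightarrow> \<bar>ht (\<phi> s x) - ht x\<bar> \<le> 1"

locale quasiparabolic_set = scaled_set G X \<phi> S ht
  for G (structure) and X and \<phi> and S :: "'a set" and ht :: "'b \<Rightarrow> int" +
  assumes QP1: "\<And>r x. \<lbrakk> r \<in> reflections G S; x \<in> X; ht (\<phi> r x) = ht x \<rbrakk> \<Longrightarrow> \<phi> r x = x"
    and QP2: "\<And>r x s. \<lbrakk> r \<in> reflections G S; x \<in> X; s \<in> S;
      ht (\<phi> r x) > ht x; ht (\<phi> s (\<phi> r x)) < ht (\<phi> s x) \<rbrakk> \<Longrightarrow> \<phi> r x = \<phi> s x"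

definition coset_action :: "('a, 'b) monoid_scheme \<Rightarrow> 'a set \<Rightarrow> 'a \<Rightarrow> 'a set \<Rightarrow> 'a set"
  where "coset_action G H g = (\<lambda>C \<in> lcosets\<^bsub>G\<^esub> H. g <#\<^bsub>G\<^esub> C)"

definition min_length :: "('a, 'b) monoid_scheme \<Rightarrow> 'a set \<Rightarrow> 'a set \<Rightarrow> int"
  where "min_length G S C = int (LEAST n. n \<in> coxeter_length G S ` C)"

definition quasiparabolic_subgroup :: "('a, 'b) monoid_scheme \<Rightarrow> 'a set \<Rightarrow> 'a set \<Rightarrow> bool"
  where "quasiparabolic_subgroup G S H \<longleftrightarrow>
    subgroup H G \<and>
    quasiparabolic_set G (lcosets\<^bsub>G\<^esub> H) (coset_action G H) S (min_length G S)"


section \<open>The quotient of a product set by a subgroup of the second factor\<close>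

text \<open>The set \<open>X/H\<close> of orbits of \<open>1 \<times> H\<close>.\<close>

definition quotient_set ::
  "('a, 'c) monoid_scheme \<Rightarrow> ('b, 'd) monoid_scheme \<Rightarrow> ('a \<times> 'b \<Rightarrow> 'x \<Rightarrow> 'x) \<Rightarrow> 'x set \<Rightarrow> 'b set
    \<Rightarrow> 'x set set"
  where "quotient_set W W' \<phi> X H = orbits (W'\<lparr>carrier := H\<rparr>) X (\<lambda>h. \<phi> (\<one>\<^bsub>W\<^esub>, h))"

text \<open>
  The action \<open>w \<cdot> (H x) = H (w x)\<close>; since the two factors commute, \<open>H (w x)\<close> is the image of
  \<open>H x\<close> under \<open>w\<close>.
\<close>

definition quotient_action ::
  "('a, 'c) monoid_scheme \<Rightarrow> ('b, 'd) monoid_scheme \<Rightarrow> ('a \<times> 'b \<Rightarrow> 'x \<Rightarrow> 'x) \<Rightarrow> 'x set \<Rightarrow> 'b set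
    \<Rightarrow> 'a \<Rightarrow> 'x set \<Rightarrow> 'x set"
  where "quotient_action W W' \<phi> X H w =
    (\<lambda>Y \<in> quotient_set W W' \<phi> X H. \<phi> (w, \<one>\<^bsub>W'\<^esub>) ` Y)"

text \<open>A genuine minimum only on nonempty sets on which \<open>ht\<close> is bounded below.\<close>

definition min_height :: "('x \<Rightarrow> int) \<Rightarrow> 'x set \<Rightarrow> int"
  where "min_height ht Y = (LEAST k. k \<in> ht ` Y)"

end

theory Submission
  imports Defs
begin

text \<open>
  Since \<open>\<ell>(h) \<ge> |ht(hx) - ht(x)|\<close>, the minimum of \<open>ht\<close> on \<open>Hx\<close> is the minimum of the height
  \<open>ht(y) + \<ell>(C)\<close> on the orbit of \<open>(x, H)\<close> under the diagonal of \<open>W' \<times> W'\<close> acting on the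
  quasiparabolic set \<open>X \<times> W'/H\<close>. Let \<open>y\<close> be minimal in its diagonal orbit, \<open>r\<close> a reflection that
  raises \<open>y\<close>, and suppose that \<open>wry\<close> is a minimal element of the orbit of \<open>ry\<close> and is not higher
  than \<open>y\<close>. Along a word for \<open>w\<close>, the order of the heights of \<open>vy\<close> and \<open>vry\<close> must change, and
  (QP2) then gives \<open>ry = ty\<close> for a reflection \<open>t\<close> in one of the two copies of \<open>W'\<close>, such that \<open>wt\<close>
  is \<open>w\<close> with one letter deleted. As the diagonal orbit of \<open>ty\<close> contains \<open>t'y\<close>, where \<open>t'\<close> is the
  same reflection in the other copy, \<open>r\<close> and \<open>w\<close> may be replaced by \<open>t'\<close> and the shorter word for
  \<open>wt\<close>; this descent must end with equal orbits. For (QP2) one inserts a simple reflection of \<open>W\<close>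
  at the start of the word.
\<close>

section \<open>Words and reflections\<close>

lemma word_prod_Nil [simp]: "word_prod G [] = \<one>\<^bsub>G\<^esub>"
  and word_prod_Cons [simp]: "word_prod G (s # ws) = s \<otimes>\<^bsub>G\<^esub> word_prod G ws"
  by (simp_all add: word_prod_def)

context group
begin

lemma word_prod_closed: "set ws \<subseteq> carrier G \<Longrightarrow> word_prod G ws \<in> carrier G"
  by (induction ws) auto

lemma word_prod_append:
  "\<lbrakk> set u \<subseteq> carrier G; set v \<subseteq> carrier G \<rbrakk> \<Longrightarrow>
    word_prod G (u @ v) = word_prod G u \<otimes> word_prod G v"
  by (induction u) (auto simp: word_prod_closed m_assoc)

lemma word_prod_surj:
  assumes "S \<subseteq> carrier G" and "\<And>s. s \<in> S \<Longrightarrow> s \<otimes> s = \<one>" and "g \<in> generate G S"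
  shows "\<exists>ws. set ws \<subseteq> S \<and> word_prod G ws = g"
  using assms(3)
proof induction
  case one
  show ?case by (rule exI[of _ "[]"]) simp
next
  case (incl h)
  then show ?case using assms(1) by (intro exI[of _ "[h]"]) auto
next
  case (inv h)
  then have "inv h = h" using assms(1,2) by (meson inv_equality subsetD)
  then show ?case using inv assms(1) by (intro exI[of _ "[h]"]) auto
next
  case (eng h1 h2)
  then obtain u v where "set u \<subseteq> S" "word_prod G u = h1" "set v \<subseteq> S" "word_prod G v = h2"
    by blast
  then show ?case using assms(1) word_prod_append[of u v] by (intro exI[of _ "u @ v"]) auto
qed

lemma reflections_closed:
  "\<lbrakk> S \<subseteq> carrier G; r \<in> reflections G S \<rbrakk> \<Longrightarrow> r \<in> carrier G"
  by (auto simp: reflections_def)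

lemma reflections_conj:
  assumes "S \<subseteq> carrier G" "r \<in> reflections G S" "g \<in> carrier G"
  shows "g \<otimes> r \<otimes> inv g \<in> reflections G S"
proof -
  obtain w s where r: "w \<in> carrier G" "s \<in> S" "r = w \<otimes> s \<otimes> inv w"
    using assms(2) by (auto simp: reflections_def)
  have "s \<in> carrier G" using r assms by auto
  then have "g \<otimes> r \<otimes> inv g = (g \<otimes> w) \<otimes> s \<otimes> inv (g \<otimes> w)"
    using r assms(3) by (simp add: m_assoc inv_mult_group)
  then show ?thesis unfolding reflections_def using r assms(3) by blast
qed

end

text \<open>A homomorphism carries conjugates to conjugates. This moves reflections of
  \<open>W\<close> and \<open>W'\<close> into the larger product group along the embeddings of the
  factors.\<close>

lemma reflections_hom:
  assumes "group G" "group K" "f \<in> hom G K" "f ` S \<subseteq> T" "S \<subseteq> carrier G"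
    and "r \<in> reflections G S"
  shows "f r \<in> reflections K T"
proof -
  interpret group_hom G K f
    using assms(1-3) by (simp add: group_hom_def group_hom_axioms_def)
  obtain w s where r: "w \<in> carrier G" "s \<in> S" "r = w \<otimes>\<^bsub>G\<^esub> s \<otimes>\<^bsub>G\<^esub> inv\<^bsub>G\<^esub> w"
    using assms(6) by (auto simp: reflections_def)
  have "s \<in> carrier G" using r(2) assms(5) by blast
  then have "f r = f w \<otimes>\<^bsub>K\<^esub> f s \<otimes>\<^bsub>K\<^esub> inv\<^bsub>K\<^esub> f w" unfolding r(3) using r(1) by simp
  moreover have "f w \<in> carrier K" "f s \<in> T" using r(1,2) assms(4) by auto
  ultimately show ?thesis unfolding reflections_def by blast
qed

context coxeter_system
begin

lemma simple_square: "s \<in> S \<Longrightarrow> s \<otimes> s = \<one>"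
  using pow_ord_eq_1[of s] simple_order[of s] simple_subset by (auto simp: numeral_2_eq_2)

lemma word_exists: "g \<in> carrier G \<Longrightarrow> \<exists>ws. set ws \<subseteq> S \<and> word_prod G ws = g"
  using word_prod_surj[OF simple_subset simple_square, of g] generates by auto

lemma coxeter_length_word:
  assumes "g \<in> carrier G"
  obtains ws where "set ws \<subseteq> S" "word_prod G ws = g" "length ws = coxeter_length G S g"
proof -
  have "\<exists>n ws. set ws \<subseteq> S \<and> word_prod G ws = g \<and> length ws = n"
    using word_exists[OF assms] by blast
  from LeastI_ex[OF this] show thesis using that unfolding coxeter_length_def by blast
qed

lemma coxeter_length_one: "coxeter_length G S \<one> = 0"
  unfolding coxeter_length_def by (rule Least_eq_0) (rule exI[of _ "[]"], simp)

end


section \<open>Group actions\<close>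

text \<open>A \<open>group_action\<close> is a homomorphism into \<open>BijGroup E\<close>, whose
  elements are extensional bijections. The action of the inverse element supplies bijectivity, and
  extensionality turns pointwise equality on \<open>E\<close> into equality of functions.\<close>

lemma group_actionI:
  assumes "group G"
    and ext: "\<And>g. g \<in> carrier G \<Longrightarrow> \<phi> g \<in> extensional E"
    and clo: "\<And>g x. \<lbrakk> g \<in> carrier G; x \<in> E \<rbrakk> \<Longrightarrow> \<phi> g x \<in> E"
    and one: "\<And>x. x \<in> E \<Longrightarrow> \<phi> \<one>\<^bsub>G\<^esub> x = x"
    and mult: "\<And>g h x. \<lbrakk> g \<in> carrier G; h \<in> carrier G; x \<in> E \<rbrakk> \<Longrightarrow>
      \<phi> (g \<otimes>\<^bsub>G\<^esub> h) x = \<phi> g (\<phi> h x)"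
  shows "group_action G E \<phi>"
proof -
  interpret group G by fact
  have inverse: "\<phi> g (\<phi> h x) = x"
    if "g \<in> carrier G" "h \<in> carrier G" "g \<otimes>\<^bsub>G\<^esub> h = \<one>\<^bsub>G\<^esub>" "x \<in> E" for g h x
    using mult[of g h x] one that by simp
  have bij: "\<phi> g \<in> Bij E" if "g \<in> carrier G" for g
  proof -
    have "bij_betw (\<phi> g) E E"
      by (rule bij_betw_byWitness[where f' = "\<phi> (inv\<^bsub>G\<^esub> g)"]) (use that in \<open>auto simp: inverse clo\<close>)
    then show ?thesis using ext that by (simp add: Bij_def)
  qed
  have "\<phi> (g \<otimes>\<^bsub>G\<^esub> h) = compose E (\<phi> g) (\<phi> h)" if "g \<in> carrier G" "h \<in> carrier G" for g h
    by (rule extensionalityI[of _ E]) (use that in \<open>auto simp: ext compose_eq mult\<close>)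
  then have "\<phi> \<in> hom G (BijGroup E)"
    by (auto simp: hom_def bij BijGroup_def)
  then show ?thesis
    by (simp add: group_action_def group_hom_def group_hom_axioms_def group_BijGroup assms(1))
qed

context group_action
begin

lemma acting_group: "group G"
  using group_hom group_hom.axioms(1) by blast

lemma act_closed: "\<lbrakk> g \<in> carrier G; x \<in> E \<rbrakk> \<Longrightarrow> \<phi> g x \<in> E"
  using element_image by blast

lemma act_one: "x \<in> E \<Longrightarrow> \<phi> \<one> x = x"
  using id_eq_one by (metis restrict_apply')

lemma act_inv: "\<lbrakk> g \<in> carrier G; x \<in> E \<rbrakk> \<Longrightarrow> \<phi> (inv g) (\<phi> g x) = x"
  using orbit_sym_aux by blast

lemma act_eq_iff: "\<lbrakk> g \<in> carrier G; x \<in> E; y \<in> E \<rbrakk> \<Longrightarrow> \<phi> g x = \<phi> g y \<longleftrightarrow> x = y"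
  using inj_prop by (auto dest: inj_onD)

text \<open>The pair \<open>x\<close>, \<open>r x\<close>, translated by \<open>g\<close>, is again
  a point and its image under a conjugate of \<open>r\<close>. This lets reflections travel along
  words.\<close>

lemma act_conj:
  assumes "g \<in> carrier G" "r \<in> carrier G" "x \<in> E"
  shows "\<phi> (g \<otimes> r \<otimes> inv g) (\<phi> g x) = \<phi> g (\<phi> r x)"
proof -
  interpret group G by (rule acting_group)
  show ?thesis using assms
    by (simp add: composition_rule act_closed act_inv)
qed

end

lemma (in scaled_set) ht_word:
  assumes "S \<subseteq> carrier G" "set ws \<subseteq> S" "x \<in> X"
  shows "\<bar>ht (\<phi> (word_prod G ws) x) - ht x\<bar> \<le> int (length ws)"
  using assms(2)
proof (induction ws)
  case Nil
  then show ?case using assms act_one by simp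
next
  case (Cons s ws)
  interpret group G by (rule acting_group)
  have "word_prod G ws \<in> carrier G" using Cons assms word_prod_closed by auto
  then show ?case
    using Cons assms ht_simple[of s "\<phi> (word_prod G ws) x"] act_closed
      composition_rule[of x s "word_prod G ws"] by auto
qed

text \<open>(QP2) forbids a strict reversal of the order of the two heights unless \<open>r\<close>
  and \<open>s\<close> agree at \<open>x\<close>. Equal heights after \<open>s\<close> are
  impossible: (QP1) for the conjugate of \<open>r\<close> by \<open>s\<close> would give
  \<open>s r x = s x\<close>, hence \<open>r x = x\<close>.\<close>

lemma (in quasiparabolic_set) QP_step:
  assumes "S \<subseteq> carrier G" "r \<in> reflections G S" "x \<in> X" "s \<in> S" "ht x < ht (\<phi> r x)"
  shows "ht (\<phi> s x) < ht (\<phi> s (\<phi> r x)) \<or> \<phi> r x = \<phi> s x"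
proof (rule ccontr)
  assume *: "\<not> ?thesis"
  interpret group G by (rule acting_group)
  have s: "s \<in> carrier G" and r: "r \<in> carrier G" using assms reflections_closed by auto
  have "\<not> ht (\<phi> s (\<phi> r x)) < ht (\<phi> s x)" using QP2 assms * by blast
  then have "ht (\<phi> s (\<phi> r x)) = ht (\<phi> s x)" using * by simp
  then have "\<phi> s (\<phi> r x) = \<phi> s x"
    using QP1[OF reflections_conj[OF assms(1,2) s], of "\<phi> s x"]
    by (simp add: act_conj act_closed s r assms)
  then show False using act_eq_iff s r act_closed assms by force
qed


section \<open>Products of quasiparabolic sets\<close>

text \<open>A simple reflection of the product is trivial in one coordinate, and conjugation keeps
  that coordinate trivial.\<close>

lemma reflections_prod_simple:
  assumes "group G" "group K" "S \<subseteq> carrier G" "T \<subseteq> carrier K"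
    and "r \<in> reflections (G \<times>\<times> K) (prod_simple G S K T)"
  shows "(\<exists>p \<in> reflections G S. r = (p, \<one>\<^bsub>K\<^esub>)) \<or> (\<exists>q \<in> reflections K T. r = (\<one>\<^bsub>G\<^esub>, q))"
proof -
  interpret G: group G by fact
  interpret K: group K by fact
  obtain a b c d where
    *: "a \<in> carrier G" "b \<in> carrier K" "(c, d) \<in> prod_simple G S K T"
      "r = (a, b) \<otimes>\<^bsub>G \<times>\<times> K\<^esub> (c, d) \<otimes>\<^bsub>G \<times>\<times> K\<^esub> inv\<^bsub>G \<times>\<times> K\<^esub> (a, b)"
    using assms(5) unfolding reflections_def by auto
  then have r: "r = (a \<otimes>\<^bsub>G\<^esub> c \<otimes>\<^bsub>G\<^esub> inv\<^bsub>G\<^esub> a, b \<otimes>\<^bsub>K\<^esub> d \<otimes>\<^bsub>K\<^esub> inv\<^bsub>K\<^esub> b)"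
    using assms by simp
  from *(3) consider "c \<in> S" "d = \<one>\<^bsub>K\<^esub>" | "c = \<one>\<^bsub>G\<^esub>" "d \<in> T"
    by (auto simp: prod_simple_def)
  then show ?thesis
  proof cases
    case 1
    then show ?thesis using r * unfolding reflections_def by auto
  next
    case 2
    then show ?thesis using r * unfolding reflections_def by auto
  qed
qed

lemma prod_simple_subset:
  "\<lbrakk> group G; group K; S \<subseteq> carrier G; T \<subseteq> carrier K \<rbrakk> \<Longrightarrow>
    prod_simple G S K T \<subseteq> carrier (G \<times>\<times> K)"
  by (auto simp: prod_simple_def group.is_monoid monoid.one_closed)

text \<open>If \<open>r\<close> and \<open>s\<close> move the same factor, the axioms of that factor
  apply. If they move different factors, \<open>s\<close> leaves the height difference between
  \<open>x\<close> and \<open>r x\<close> unchanged, so the hypotheses of (QP2) contradict each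
  other.\<close>

lemma quasiparabolic_set_prod:
  assumes G: "quasiparabolic_set G X \<phi> S ht" "S \<subseteq> carrier G"
    and K: "quasiparabolic_set K Y \<psi> T ht'" "T \<subseteq> carrier K"
  shows "quasiparabolic_set (G \<times>\<times> K) (X \<times> Y)
    (\<lambda>g. \<lambda>p \<in> X \<times> Y. (\<phi> (fst g) (fst p), \<psi> (snd g) (snd p))) (prod_simple G S K T)
    (\<lambda>p. ht (fst p) + ht' (snd p))" (is "quasiparabolic_set _ _ ?act ?ST ?ht")
proof -
  interpret X: quasiparabolic_set G X \<phi> S ht by fact
  interpret Y: quasiparabolic_set K Y \<psi> T ht' by fact
  interpret G: group G by (rule X.acting_group)
  interpret K: group K by (rule Y.acting_group)
  have refl: "(\<exists>p \<in> reflections G S. r = (p, \<one>\<^bsub>K\<^esub>)) \<or> (\<exists>q \<in> reflections K T. r = (\<one>\<^bsub>G\<^esub>, q))"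
    if "r \<in> reflections (G \<times>\<times> K) ?ST" for r
    using reflections_prod_simple[OF _ _ G(2) K(2) that] X.acting_group Y.acting_group by blast
  have "group_action (G \<times>\<times> K) (X \<times> Y) ?act"
    by (rule group_actionI)
      (auto simp: DirProd_group X.acting_group Y.acting_group X.act_closed Y.act_closed
        X.act_one Y.act_one X.composition_rule Y.composition_rule)
  then interpret P: group_action "G \<times>\<times> K" "X \<times> Y" ?act .
  note simps = X.act_one Y.act_one X.act_closed Y.act_closed
  have GK: "\<And>s. s \<in> S \<Longrightarrow> s \<in> carrier G" "\<And>s. s \<in> T \<Longrightarrow> s \<in> carrier K"
    "\<And>r. r \<in> reflections G S \<Longrightarrow> r \<in> carrier G" "\<And>r. r \<in> reflections K T \<Longrightarrow> r \<in> carrier K"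
    using G K G.reflections_closed K.reflections_closed by blast+
  show ?thesis
  proof unfold_locales
    fix s x assume s: "s \<in> ?ST" and x: "x \<in> X \<times> Y"
    from s show "\<bar>?ht (?act s x) - ?ht x\<bar> \<le> 1"
      unfolding prod_simple_def using x by (auto simp: simps X.ht_simple Y.ht_simple)
  next
    fix r x assume r: "r \<in> reflections (G \<times>\<times> K) ?ST" and x: "x \<in> X \<times> Y"
      and eq: "?ht (?act r x) = ?ht x"
    from refl[OF r] show "?act r x = x"
    proof (elim disjE bexE)
      fix p assume p: "p \<in> reflections G S" "r = (p, \<one>\<^bsub>K\<^esub>)"
      then show ?thesis using x eq X.QP1[of p "fst x"] by (auto simp: simps)
    next
      fix p assume p: "p \<in> reflections K T" "r = (\<one>\<^bsub>G\<^esub>, p)"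
      then show ?thesis using x eq Y.QP1[of p "snd x"] by (auto simp: simps)
    qed
  next
    fix r x s assume r: "r \<in> reflections (G \<times>\<times> K) ?ST" and x: "x \<in> X \<times> Y" and s: "s \<in> ?ST"
      and up: "?ht x < ?ht (?act r x)" and down: "?ht (?act s (?act r x)) < ?ht (?act s x)"
    from s consider a where "a \<in> S" "s = (a, \<one>\<^bsub>K\<^esub>)" | a where "a \<in> T" "s = (\<one>\<^bsub>G\<^esub>, a)"
      by (auto simp: prod_simple_def)
    note s_cases = this
    from refl[OF r] show "?act r x = ?act s x"
    proof (elim disjE bexE)
      fix p assume p: "p \<in> reflections G S" "r = (p, \<one>\<^bsub>K\<^esub>)"
      from s_cases show ?thesis
      proof cases
        case 1
        then show ?thesis using p x up down X.QP2[of p "fst x" a] by (auto simp: simps GK)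
      next
        case 2
        then show ?thesis using p x up down by (auto simp: simps GK)
      qed
    next
      fix p assume p: "p \<in> reflections K T" "r = (\<one>\<^bsub>G\<^esub>, p)"
      from s_cases show ?thesis
      proof cases
        case 1
        then show ?thesis using p x up down by (auto simp: simps GK)
      next
        case 2
        then show ?thesis using p x up down Y.QP2[of p "snd x" a] by (auto simp: simps GK)
      qed
    qed
  qed
qed


section \<open>Two commuting copies of a group\<close>

text \<open>In the application \<open>K\<close> is \<open>W'\<close>, \<open>U\<close> is
  \<open>S'\<close>, and \<open>i1\<close>, \<open>i2\<close> embed \<open>W'\<close> into the two
  \<open>W'\<close> factors of \<open>(W \<times>\<times> W') \<times>\<times> W'\<close>.\<close>

locale commuting_copies = quasiparabolic_set G X \<phi> S ht + K: group K
  for G (structure) and X and \<phi> and S :: "'a set" and ht :: "'b \<Rightarrow> int"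
    and K :: "('k, 'm) monoid_scheme" +
  fixes U :: "'k set" and i1 i2 :: "'k \<Rightarrow> 'a"
  assumes simple_closed: "S \<subseteq> carrier G"
    and gens_closed: "U \<subseteq> carrier K"
    and gens_square: "\<And>u. u \<in> U \<Longrightarrow> u \<otimes>\<^bsub>K\<^esub> u = \<one>\<^bsub>K\<^esub>"
    and i1_hom: "i1 \<in> hom K G"
    and i2_hom: "i2 \<in> hom K G"
    and i1_gens: "i1 ` U \<subseteq> S"
    and i2_gens: "i2 ` U \<subseteq> S"
    and copies_commute: "\<And>a b. \<lbrakk> a \<in> carrier K; b \<in> carrier K \<rbrakk> \<Longrightarrow> i1 a \<otimes> i2 b = i2 b \<otimes> i1 a"
begin

sublocale G: group G
  by (rule acting_group)

sublocale i1: group_hom K G i1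
  using i1_hom by unfold_locales

sublocale i2: group_hom K G i2
  using i2_hom by unfold_locales

section \<open>The diagonal of the two copies\<close>

definition diag :: "'k \<Rightarrow> 'a"
  where "diag k = i1 k \<otimes> i2 k"

abbreviation act_diag :: "'k \<Rightarrow> 'b \<Rightarrow> 'b"
  where "act_diag k \<equiv> \<phi> (diag k)"

lemma diag_closed [simp, intro]: "k \<in> carrier K \<Longrightarrow> diag k \<in> carrier G"
  by (simp add: diag_def)

lemma diag_one [simp]: "diag \<one>\<^bsub>K\<^esub> = \<one>"
  by (simp add: diag_def)

lemma left_commute:
  assumes "a \<in> carrier K" "b \<in> carrier K" "g \<in> carrier G"
  shows "i2 b \<otimes> (i1 a \<otimes> g) = i1 a \<otimes> (i2 b \<otimes> g)"
  using assms by (simp add: copies_commute flip: G.m_assoc)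

lemma diag_mult:
  assumes "a \<in> carrier K" "b \<in> carrier K"
  shows "diag (a \<otimes>\<^bsub>K\<^esub> b) = diag a \<otimes> diag b"
  using assms by (simp add: diag_def G.m_assoc left_commute)

text \<open>For \<open>t = v^-1 s v\<close>, both sides have the coordinates
  \<open>(s v, v)\<close>, respectively \<open>(v, s v)\<close>, in the two copies. Thus a simple
  reflection at the point \<open>diag v y\<close> pulls back to a reflection at \<open>y\<close> in
  the same copy.\<close>

lemma diag_conj:
  assumes "s \<in> carrier K" "v \<in> carrier K"
  shows "diag v \<otimes> i1 (inv\<^bsub>K\<^esub> v \<otimes>\<^bsub>K\<^esub> s \<otimes>\<^bsub>K\<^esub> v) = i1 s \<otimes> diag v"
    and "diag v \<otimes> i2 (inv\<^bsub>K\<^esub> v \<otimes>\<^bsub>K\<^esub> s \<otimes>\<^bsub>K\<^esub> v) = i2 s \<otimes> diag v"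
proof -
  define t where "t = inv\<^bsub>K\<^esub> v \<otimes>\<^bsub>K\<^esub> s \<otimes>\<^bsub>K\<^esub> v"
  have t: "t \<in> carrier K" "v \<otimes>\<^bsub>K\<^esub> t = s \<otimes>\<^bsub>K\<^esub> v"
    using assms by (simp_all add: t_def flip: K.m_assoc)
  have "diag v \<otimes> i1 t = i1 (v \<otimes>\<^bsub>K\<^esub> t) \<otimes> i2 v"
    using t(1) assms(2) copies_commute[of t v] by (simp add: diag_def G.m_assoc)
  then show "diag v \<otimes> i1 (inv\<^bsub>K\<^esub> v \<otimes>\<^bsub>K\<^esub> s \<otimes>\<^bsub>K\<^esub> v) = i1 s \<otimes> diag v"
    unfolding t(2) t_def[symmetric] using assms by (simp add: diag_def G.m_assoc)
  have "diag v \<otimes> i2 t = i1 v \<otimes> i2 (v \<otimes>\<^bsub>K\<^esub> t)"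
    using t(1) assms(2) by (simp add: diag_def G.m_assoc)
  then show "diag v \<otimes> i2 (inv\<^bsub>K\<^esub> v \<otimes>\<^bsub>K\<^esub> s \<otimes>\<^bsub>K\<^esub> v) = i2 s \<otimes> diag v"
    unfolding t(2) t_def[symmetric] using assms by (simp add: diag_def left_commute)
qed

text \<open>Induction along the word, whose last letter acts first. While the order of the heights
  survives, the next letter \<open>s\<close> acts as \<open>i2 s\<close> followed by
  \<open>i1 s\<close>, both simple. \<open>QP_step\<close> applies to each half: either the order is
  kept, or the conjugated reflection agrees with that simple reflection, and this agreement pulls
  back to \<open>y\<close>.\<close>

lemma diag_word_step:
  assumes "set ws \<subseteq> U" "r \<in> reflections G S" "y \<in> X" "ht y < ht (\<phi> r y)"
  shows "ht (act_diag (word_prod K ws) y) < ht (act_diag (word_prod K ws) (\<phi> r y)) \<or>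
    (\<exists>p s v t. ws = p @ s # v \<and>
      t = inv\<^bsub>K\<^esub> (word_prod K v) \<otimes>\<^bsub>K\<^esub> s \<otimes>\<^bsub>K\<^esub> word_prod K v \<and>
      (\<phi> r y = \<phi> (i1 t) y \<or> \<phi> r y = \<phi> (i2 t) y))"
  using assms(1)
proof (induction ws)
  case Nil
  have "r \<in> carrier G" using assms simple_closed G.reflections_closed by blast
  then show ?case using assms by (simp add: act_one act_closed)
next
  case (Cons s ws)
  let ?v = "word_prod K ws"
  let ?a = "diag ?v"
  let ?t = "inv\<^bsub>K\<^esub> ?v \<otimes>\<^bsub>K\<^esub> s \<otimes>\<^bsub>K\<^esub> ?v"
  have r: "r \<in> carrier G" using assms simple_closed G.reflections_closed by blast
  have v: "?v \<in> carrier K" and s: "s \<in> carrier K" "s \<in> U"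
    using Cons.prems gens_closed K.word_prod_closed by auto
  have iS: "i1 s \<in> S" "i2 s \<in> S" using s i1_gens i2_gens by auto
  note clo = act_closed r v s assms(3)
  have t: "?t \<in> carrier K" using v s by simp
  from Cons consider (deleted) "\<exists>p s' v t. ws = p @ s' # v \<and>
      t = inv\<^bsub>K\<^esub> (word_prod K v) \<otimes>\<^bsub>K\<^esub> s' \<otimes>\<^bsub>K\<^esub> word_prod K v \<and>
      (\<phi> r y = \<phi> (i1 t) y \<or> \<phi> r y = \<phi> (i2 t) y)"
    | (up) "ht (\<phi> ?a y) < ht (\<phi> ?a (\<phi> r y))"
    by (auto simp only: list.set insert_subset)
  then show ?case
  proof cases
    case deleted
    then show ?thesis by (metis append_Cons)
  next
    case up
    have conj: "\<phi> ?a (\<phi> r y) = \<phi> (?a \<otimes> r \<otimes> inv ?a) (\<phi> ?a y)"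
      "?a \<otimes> r \<otimes> inv ?a \<in> reflections G S"
      using act_conj[of ?a r y] G.reflections_conj[OF simple_closed assms(2)] clo by auto
    have head: ?thesis if "\<phi> r y = \<phi> (i1 ?t) y \<or> \<phi> r y = \<phi> (i2 ?t) y"
      by (rule disjI2, intro exI[of _ "[]"] exI[of _ s] exI[of _ ws] exI[of _ ?t])
        (use that in auto)
    have i1t: "\<phi> ?a (\<phi> (i1 ?t) y) = \<phi> (i1 s) (\<phi> ?a y)"
      and i2t: "\<phi> ?a (\<phi> (i2 ?t) y) = \<phi> (i2 s) (\<phi> ?a y)"
      using diag_conj[OF s(1) v] t v s assms(3)
      by (simp_all add: diag_closed i1.hom_closed i2.hom_closed flip: composition_rule
          del: i1.hom_mult i2.hom_mult)
    let ?b = "i2 s"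
    let ?r = "?a \<otimes> r \<otimes> inv ?a"
    have y1: "\<phi> ?a y \<in> X" using clo by auto
    have r1: "?r \<in> carrier G" using conj G.reflections_closed simple_closed by blast
    from QP_step[OF simple_closed conj(2) y1 iS(2)] up conj(1)
    consider (eq) "\<phi> ?a (\<phi> r y) = \<phi> ?b (\<phi> ?a y)"
      | (lt) "ht (\<phi> ?b (\<phi> ?a y)) < ht (\<phi> ?b (\<phi> ?r (\<phi> ?a y)))" by auto
    then show ?thesis
    proof cases
      case eq
      then have "\<phi> ?a (\<phi> r y) = \<phi> ?a (\<phi> (i2 ?t) y)" using i2t by simp
      then have "\<phi> r y = \<phi> (i2 ?t) y" using act_eq_iff t clo by simp
      then show ?thesis using head by blast
    next
      case lt
      have conj2: "\<phi> ?b (\<phi> ?r (\<phi> ?a y)) = \<phi> (?b \<otimes> ?r \<otimes> inv ?b) (\<phi> ?b (\<phi> ?a y))"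
        "?b \<otimes> ?r \<otimes> inv ?b \<in> reflections G S"
        using act_conj[of ?b ?r "\<phi> ?a y"] r1 y1 G.reflections_conj[OF simple_closed conj(2)] s
        by auto
      have y2: "\<phi> ?b (\<phi> ?a y) \<in> X" using s y1 act_closed by auto
      from QP_step[OF simple_closed conj2(2) y2 iS(1)] lt conj2(1)
      consider (eq) "\<phi> ?b (\<phi> ?r (\<phi> ?a y)) = \<phi> (i1 s) (\<phi> ?b (\<phi> ?a y))"
        | (lt) "ht (\<phi> (i1 s) (\<phi> ?b (\<phi> ?a y))) < ht (\<phi> (i1 s) (\<phi> ?b (\<phi> ?r (\<phi> ?a y))))"
        by auto
      then show ?thesis
      proof cases
        case eq
        \<comment> \<open>Here the agreement appears only after \<open>?b\<close> has acted. As the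
          copies commute, \<open>?b\<close> can be moved outermost and cancelled.\<close>
        have "\<phi> (i1 s) (\<phi> ?b (\<phi> ?a y)) = \<phi> ?b (\<phi> (i1 s) (\<phi> ?a y))"
          using copies_commute[of s s] s y1 by (simp flip: composition_rule)
        then have "\<phi> ?b (\<phi> ?a (\<phi> r y)) = \<phi> ?b (\<phi> ?a (\<phi> (i1 ?t) y))"
          using eq i1t conj(1) by simp
        then have "\<phi> r y = \<phi> (i1 ?t) y" using act_eq_iff t clo by simp
        then show ?thesis using head by blast
      next
        case lt
        have *: "act_diag (word_prod K (s # ws)) x = \<phi> (i1 s) (\<phi> ?b (\<phi> ?a x))" if "x \<in> X" for x
          using that v s diag_mult[OF s(1) v] diag_def[of s]
          by (simp add: composition_rule act_closed)
        show ?thesis using lt conj(1) *[of y] *[of "\<phi> r y"] clo by simp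
      qed
    qed
  qed
qed

text \<open>The cases \<open>z = \<one>\<close> and \<open>z \<in> S\<close> yield (QP1) and (QP2) for the quotient by the diagonal.\<close>

lemma diag_descent:
  assumes y: "y \<in> X" and z: "z \<in> carrier G" "z = \<one> \<or> z \<in> S \<and> ht y < ht (\<phi> z y)"
    and z1: "\<And>k. k \<in> carrier K \<Longrightarrow> z \<otimes> i1 k = i1 k \<otimes> z"
    and z2: "\<And>k. k \<in> carrier K \<Longrightarrow> z \<otimes> i2 k = i2 k \<otimes> z"
    and min: "\<And>k. k \<in> carrier K \<Longrightarrow> ht (\<phi> z y) \<le> ht (act_diag k (\<phi> z y))"
    and "set ws \<subseteq> U" and "r \<in> reflections G S"
    and "\<And>k. k \<in> carrier K \<Longrightarrow> ht (\<phi> z y) \<le> ht (act_diag k (\<phi> r y))"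
    and "ht (act_diag (word_prod K ws) (\<phi> z (\<phi> r y))) \<le> ht y"
  shows "\<exists>k \<in> carrier K. \<phi> r y = act_diag k (\<phi> z y)"
  using assms(7-10)
\<comment> \<open>The reflection changes together with the word, while \<open>y\<close> and
  \<open>z\<close> stay fixed.\<close>
proof (induction "length ws" arbitrary: ws r rule: less_induct)
  case less
  note r = less.prems(2)
  have rc: "r \<in> carrier G" using r simple_closed G.reflections_closed by blast
  note clo = act_closed rc y z(1)
  have zy: "\<phi> z y \<in> X" using clo by blast
  have le: "ht y \<le> ht (\<phi> z y)" using z(2) y act_one by auto
  have here: ?case if "\<phi> r y = \<phi> z y"
    using that zy by (intro bexI[of _ "\<one>\<^bsub>K\<^esub>"]) (auto simp: act_one)
  have le_r: "ht (\<phi> z y) \<le> ht (\<phi> r y)"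
    using less.prems(3)[of "\<one>\<^bsub>K\<^esub>"] clo by (simp add: act_one)
  show ?case
  proof (cases "ht (\<phi> r y) = ht y")
    case True
    \<comment> \<open>A simple \<open>z\<close> would raise \<open>y\<close> strictly, against
      \<open>ht (z y) \<le> ht (r y) = ht y\<close>.\<close>
    then have "z = \<one>" using z(2) le_r by auto
    then show ?thesis using here QP1[OF r y True] act_one[OF y] by simp
  next
    case False
    then have up: "ht y < ht (\<phi> r y)" using le le_r by simp
    have "ht (\<phi> z y) < ht (\<phi> z (\<phi> r y)) \<or> \<phi> r y = \<phi> z y"
      using z(2) up QP_step[OF simple_closed r y _ up] y clo act_one by auto
    then show ?thesis
    proof (elim disjE)
      assume up_z: "ht (\<phi> z y) < ht (\<phi> z (\<phi> r y))"
      have conj: "\<phi> (z \<otimes> r \<otimes> inv z) (\<phi> z y) = \<phi> z (\<phi> r y)"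
        "z \<otimes> r \<otimes> inv z \<in> reflections G S"
        using act_conj G.reflections_conj[OF simple_closed r] clo by auto
      let ?w = "word_prod K ws"
      have w: "?w \<in> carrier K" using less.prems(1) gens_closed K.word_prod_closed by auto
      \<comment> \<open>The order of \<open>z y\<close> and \<open>z r y\<close> cannot survive the
        whole word: \<open>diag ?w\<close> takes the first to height at least \<open>ht y\<close>
        and the second to height at most \<open>ht y\<close>.\<close>
      have "ht y \<le> ht (act_diag ?w (\<phi> z y))" using min[OF w] le by simp
      then obtain p s v t where ws: "ws = p @ s # v"
        and t_def: "t = inv\<^bsub>K\<^esub> (word_prod K v) \<otimes>\<^bsub>K\<^esub> s \<otimes>\<^bsub>K\<^esub> word_prod K v"
        and rt: "\<phi> z (\<phi> r y) = \<phi> (i1 t) (\<phi> z y) \<or> \<phi> z (\<phi> r y) = \<phi> (i2 t) (\<phi> z y)"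
        using diag_word_step[OF less.prems(1) conj(2) zy] up_z conj(1) less.prems(4) by force
      have v: "set p \<subseteq> carrier K" "set v \<subseteq> carrier K" "word_prod K p \<in> carrier K"
          "word_prod K v \<in> carrier K" and s: "s \<in> U" "s \<in> carrier K"
        using less.prems(1) gens_closed ws K.word_prod_closed by auto
      have t: "t \<in> carrier K" using v s by (simp add: t_def)
      have vt: "word_prod K v \<otimes>\<^bsub>K\<^esub> t = s \<otimes>\<^bsub>K\<^esub> word_prod K v"
        using v s by (simp add: t_def flip: K.m_assoc)
      have "s \<otimes>\<^bsub>K\<^esub> (s \<otimes>\<^bsub>K\<^esub> word_prod K v) = word_prod K v"
        using gens_square[OF s(1)] s v by (simp flip: K.m_assoc)
      \<comment> \<open>Right multiplication by \<open>t\<close> deletes the letter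
        \<open>s\<close>: \<open>p s v (v^-1 s v) = p v\<close>.\<close>
      then have wt: "word_prod K (p @ v) = ?w \<otimes>\<^bsub>K\<^esub> t"
        using v s t by (simp add: ws K.word_prod_append K.m_assoc vt)
      have "t \<otimes>\<^bsub>K\<^esub> t = inv\<^bsub>K\<^esub> (word_prod K v) \<otimes>\<^bsub>K\<^esub> (s \<otimes>\<^bsub>K\<^esub> (word_prod K v \<otimes>\<^bsub>K\<^esub> t))"
        using v s t by (subst (1) t_def) (simp add: K.m_assoc)
      also have "\<dots> = \<one>\<^bsub>K\<^esub>"
        using v s gens_square[OF s(1)] by (simp add: vt flip: K.m_assoc)
      finally have tt: "t \<otimes>\<^bsub>K\<^esub> t = \<one>\<^bsub>K\<^esub>" .
      have tK: "t \<in> reflections K U"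
        unfolding reflections_def t_def using v s
        by (intro CollectI exI[of _ "inv\<^bsub>K\<^esub> (word_prod K v)"] exI[of _ s]) auto
      have refl: "i1 t \<in> reflections G S" "i2 t \<in> reflections G S"
        using reflections_hom[OF _ _ i1_hom i1_gens gens_closed tK]
          reflections_hom[OF _ _ i2_hom i2_gens gens_closed tK] acting_group K.group_axioms
        by blast+
      have i1tt: "i1 t \<otimes> (i1 t \<otimes> g) = g" and i2tt: "i2 t \<otimes> (i2 t \<otimes> g) = g"
        if "g \<in> carrier G" for g
        using tt[THEN arg_cong, of i1] tt[THEN arg_cong, of i2] t that
        by (simp_all flip: G.m_assoc)
      have i12: "i1 t \<otimes> i1 t = \<one>" "i2 t \<otimes> i2 t = \<one>"
        using tt[THEN arg_cong, of i1] tt[THEN arg_cong, of i2] t by simp_all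
      have swap: "diag t \<otimes> i1 t = i2 t" "diag t \<otimes> i2 t = i1 t"
        using t i1tt i2tt copies_commute[of t t] i12 by (simp_all add: diag_def G.m_assoc)
      \<comment> \<open>\<open>a\<close> is the copy of \<open>t\<close> that agrees with \<open>r\<close> at \<open>y\<close>, and \<open>b\<close> the other copy.\<close>
      obtain a b where a: "a \<in> carrier G" and b: "b \<in> carrier G" "b \<in> reflections G S"
        and za: "\<phi> z (\<phi> r y) = \<phi> a (\<phi> z y)" and ab: "diag t \<otimes> a = b" "diag t \<otimes> b = a"
        and az: "z \<otimes> a = a \<otimes> z" and bz: "z \<otimes> b = b \<otimes> z"
      proof (rule disjE[OF rt])
        assume "\<phi> z (\<phi> r y) = \<phi> (i1 t) (\<phi> z y)"
        then show thesis using that[of "i1 t" "i2 t"] swap refl t z1 z2 by simp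
      next
        assume "\<phi> z (\<phi> r y) = \<phi> (i2 t) (\<phi> z y)"
        then show thesis using that[of "i2 t" "i1 t"] swap refl t z1 z2 by simp
      qed
      have "\<phi> a (\<phi> z y) = \<phi> z (\<phi> a y)"
        using az a y z(1) by (simp flip: composition_rule)
      \<comment> \<open>Since \<open>z\<close> commutes with both copies, it cancels from
        \<open>z r y = a z y\<close>.\<close>
      then have ra: "\<phi> r y = \<phi> a y" using za act_eq_iff[OF z(1)] a clo by simp
      have dta: "act_diag t (\<phi> a x) = \<phi> b x" and dtb: "act_diag t (\<phi> b x) = \<phi> a x"
        if "x \<in> X" for x
        using ab that a b t by (simp_all flip: composition_rule)
      have "\<exists>k \<in> carrier K. \<phi> b y = act_diag k (\<phi> z y)"
      proof (rule less.hyps)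
        show "length (p @ v) < length ws" "set (p @ v) \<subseteq> U" using less.prems(1) ws by auto
        show "b \<in> reflections G S" by fact
        show "ht (\<phi> z y) \<le> ht (act_diag k (\<phi> b y))" if k: "k \<in> carrier K" for k
        proof -
          \<comment> \<open>\<open>b y = diag t (r y)\<close> lies in the diagonal orbit of
            \<open>r y\<close>, so the lower bound on that orbit carries over.\<close>
          have "act_diag k (\<phi> b y) = act_diag (k \<otimes>\<^bsub>K\<^esub> t) (\<phi> r y)"
            using k t a y act_closed
            by (simp add: ra diag_mult composition_rule dta[OF y])
          then show ?thesis using less.prems(3) k t by simp
        qed
        have "\<phi> z (\<phi> b y) = \<phi> b (\<phi> z y)"
          using bz b y z(1) by (simp flip: composition_rule)
        \<comment> \<open>The shorter word reaches the same point as before: \<open>w t\<close>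
          applied to \<open>b z y\<close> is \<open>w\<close> applied to
          \<open>a z y\<close>.\<close>
        then have "act_diag (word_prod K (p @ v)) (\<phi> z (\<phi> b y)) = act_diag ?w (\<phi> z (\<phi> r y))"
          using w t b zy act_closed
          by (simp add: wt diag_mult composition_rule dtb za)
        then show "ht (act_diag (word_prod K (p @ v)) (\<phi> z (\<phi> b y))) \<le> ht y"
          using less.prems(4) by simp
      qed
      then obtain k where k: "k \<in> carrier K" "\<phi> b y = act_diag k (\<phi> z y)" by blast
      have "\<phi> r y = act_diag (t \<otimes>\<^bsub>K\<^esub> k) (\<phi> z y)"
        using dtb[OF y] ra k t zy by (simp add: diag_mult composition_rule)
      then show ?thesis using k t by blast
    qed (rule here)
  qed
qed

end


section \<open>Minima over orbits and cosets\<close>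

lemma min_height_attained:
  assumes "Y \<noteq> {}" "bdd_below (ht ` Y)"
  obtains y where "y \<in> Y" "ht y = min_height ht Y" "\<And>z. z \<in> Y \<Longrightarrow> min_height ht Y \<le> ht z"
proof -
  obtain b where b: "\<And>y. y \<in> Y \<Longrightarrow> b \<le> ht y" using assms(2) by (auto simp: bdd_below_def)
  \<comment> \<open>Subtracting the bound \<open>b\<close> makes all heights nonnegative, so
    \<open>nat\<close> preserves their order and a least value exists.\<close>
  obtain y where y: "y \<in> Y" "\<And>z. z \<in> Y \<Longrightarrow> nat (ht y - b) \<le> nat (ht z - b)"
    using ex_has_least_nat[of "\<lambda>y. y \<in> Y" _ "\<lambda>y. nat (ht y - b)"] assms(1) by blast
  have le: "ht y \<le> ht z" if "z \<in> Y" for z using y(2)[OF that] b[OF that] by simp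
  have "min_height ht Y = ht y"
    unfolding min_height_def by (rule Least_equality) (use y(1) le in auto)
  then show thesis using that y(1) le by simp
qed

text \<open>Facts about the base point \<open>H\<close> of the coset space. The last one bounds its
  stabilizer and later turns \<open>k H = H\<close> into \<open>k \<in> H\<close>.\<close>

lemma (in group) coset_action_self:
  assumes "subgroup H G"
  shows "H \<in> lcosets H" "k \<in> carrier G \<Longrightarrow> coset_action G H k H = k <# H"
    "k \<in> carrier G \<Longrightarrow> k <# H = H \<Longrightarrow> k \<in> H"
proof -
  have "\<one> <# H = H" using lcos_mult_one subgroup.subset[OF assms] by blast
  then show *: "H \<in> lcosets H" unfolding LCOSETS_def by force
  show "k \<in> carrier G \<Longrightarrow> coset_action G H k H = k <# H"
    using * by (simp add: coset_action_def)
  show "k \<in> carrier G \<Longrightarrow> k <# H = H \<Longrightarrow> k \<in> H"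
    using lcos_self[OF _ assms] by blast
qed

context coxeter_system
begin

lemma min_length_attained:
  assumes "C \<noteq> {}"
  obtains v where "v \<in> C" "min_length G S C = int (coxeter_length G S v)"
proof -
  have "\<exists>n. n \<in> coxeter_length G S ` C" using assms by blast
  from LeastI_ex[OF this] show thesis using that unfolding min_length_def by auto
qed

text \<open>The base coset contains the identity. Consequently \<open>(x, H)\<close> has height
  \<open>ht x\<close> in the product with the coset space.\<close>

lemma min_length_subgroup:
  assumes "subgroup H G"
  shows "min_length G S H = 0"
proof -
  have "0 \<in> coxeter_length G S ` H"
    using subgroup.one_closed[OF assms] coxeter_length_one by (metis image_eqI)
  then show ?thesis by (simp add: min_length_def Least_eq_0)
qed

end


section \<open>The quotient\<close>

locale quasiparabolic_quotient = W: coxeter_system W S + W': coxeter_system W' S' +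
  quasiparabolic_set "W \<times>\<times> W'" X \<phi> "prod_simple W S W' S'" ht
  for W :: "('a, 'c) monoid_scheme" and S :: "'a set"
    and W' :: "('b, 'd) monoid_scheme" and S' :: "'b set"
    and X :: "'x set" and \<phi> :: "'a \<times> 'b \<Rightarrow> 'x \<Rightarrow> 'x" and ht :: "'x \<Rightarrow> int" +
  fixes H :: "'b set"
  assumes quasiparabolic_H: "quasiparabolic_subgroup W' S' H"
    and bounded: "\<And>Y. Y \<in> quotient_set W W' \<phi> X H \<Longrightarrow> bdd_below (ht ` Y)"
begin

section \<open>The two factor actions and the orbits of \<open>H\<close>\<close>

abbreviation L :: "'a \<Rightarrow> 'x \<Rightarrow> 'x" where "L w \<equiv> \<phi> (w, \<one>\<^bsub>W'\<^esub>)"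

abbreviation R :: "'b \<Rightarrow> 'x \<Rightarrow> 'x" where "R v \<equiv> \<phi> (\<one>\<^bsub>W\<^esub>, v)"

definition orb :: "'x \<Rightarrow> 'x set" where "orb x = (\<lambda>h. R h x) ` H"

lemma subgroup_H: "subgroup H W'"
  using quasiparabolic_H by (simp add: quasiparabolic_subgroup_def)

lemma H_closed: "h \<in> H \<Longrightarrow> h \<in> carrier W'"
  using subgroup.mem_carrier[OF subgroup_H] .

lemma L_closed [simp]: "\<lbrakk> w \<in> carrier W; x \<in> X \<rbrakk> \<Longrightarrow> L w x \<in> X"
  by (simp add: act_closed)

lemma R_closed [simp]: "\<lbrakk> v \<in> carrier W'; x \<in> X \<rbrakk> \<Longrightarrow> R v x \<in> X"
  by (simp add: act_closed)

lemma act_one_pair [simp]: "x \<in> X \<Longrightarrow> \<phi> (\<one>\<^bsub>W\<^esub>, \<one>\<^bsub>W'\<^esub>) x = x"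
  using act_one by simp

lemma L_mult: "\<lbrakk> w \<in> carrier W; w' \<in> carrier W; x \<in> X \<rbrakk> \<Longrightarrow> L (w \<otimes>\<^bsub>W\<^esub> w') x = L w (L w' x)"
  using composition_rule[of x "(w, \<one>\<^bsub>W'\<^esub>)" "(w', \<one>\<^bsub>W'\<^esub>)"] by simp

lemma R_mult: "\<lbrakk> v \<in> carrier W'; v' \<in> carrier W'; x \<in> X \<rbrakk> \<Longrightarrow> R (v \<otimes>\<^bsub>W'\<^esub> v') x = R v (R v' x)"
  using composition_rule[of x "(\<one>\<^bsub>W\<^esub>, v)" "(\<one>\<^bsub>W\<^esub>, v')"] by simp

lemma L_R: "\<lbrakk> w \<in> carrier W; v \<in> carrier W'; x \<in> X \<rbrakk> \<Longrightarrow> L w (R v x) = R v (L w x)"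
  using composition_rule[of x "(w, \<one>\<^bsub>W'\<^esub>)" "(\<one>\<^bsub>W\<^esub>, v)"]
    composition_rule[of x "(\<one>\<^bsub>W\<^esub>, v)" "(w, \<one>\<^bsub>W'\<^esub>)"] by simp

lemma quotient_set_eq: "quotient_set W W' \<phi> X H = orb ` X"
  by (auto simp: quotient_set_def orbits_def orbit_def orb_def)

lemma orb_self: "x \<in> X \<Longrightarrow> x \<in> orb x"
  unfolding orb_def using subgroup.one_closed[OF subgroup_H] by force

lemma orb_subset: "x \<in> X \<Longrightarrow> orb x \<subseteq> X"
  by (auto simp: orb_def H_closed)

lemma L_orb: "\<lbrakk> w \<in> carrier W; x \<in> X \<rbrakk> \<Longrightarrow> L w ` orb x = orb (L w x)"
  by (auto simp: orb_def L_R H_closed image_image)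

lemma orb_R:
  assumes "h \<in> H" "x \<in> X"
  shows "orb (R h x) = orb x"
proof -
  note hc = H_closed[OF assms(1)]
  \<comment> \<open>Right multiplication by \<open>h\<close> maps \<open>H\<close> onto
    itself.\<close>
  have "\<exists>k' \<in> H. k = k' \<otimes>\<^bsub>W'\<^esub> h" if k: "k \<in> H" for k
  proof
    show "k = (k \<otimes>\<^bsub>W'\<^esub> inv\<^bsub>W'\<^esub> h) \<otimes>\<^bsub>W'\<^esub> h"
      using H_closed[OF k] hc by (simp add: W'.m_assoc)
    show "k \<otimes>\<^bsub>W'\<^esub> inv\<^bsub>W'\<^esub> h \<in> H"
      using k assms(1) by (simp add: subgroup_H subgroup.m_closed subgroup.m_inv_closed)
  qed
  then have "(\<lambda>k. k \<otimes>\<^bsub>W'\<^esub> h) ` H = H"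
    using subgroup.m_closed[OF subgroup_H _ assms(1)] by blast
  then have "orb x = (\<lambda>k. R k x) ` (\<lambda>k. k \<otimes>\<^bsub>W'\<^esub> h) ` H"
    by (simp only: orb_def)
  also have "\<dots> = orb (R h x)"
    unfolding orb_def image_image using assms(2) hc by (simp add: R_mult H_closed cong: image_cong)
  finally show ?thesis by simp
qed

lemma orb_eq:
  assumes "y \<in> orb x" "x \<in> X"
  shows "orb y = orb x"
proof -
  obtain h where "h \<in> H" "y = R h x" using assms(1) unfolding orb_def by blast
  then show ?thesis using orb_R assms(2) by simp
qed

lemma orb_bounded: "x \<in> X \<Longrightarrow> bdd_below (ht ` orb x)"
  by (rule bounded) (simp add: quotient_set_eq)

section \<open>Minimal heights on orbits\<close>

abbreviation ht' :: "'x set \<Rightarrow> int" where "ht' \<equiv> min_height ht"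

lemma ht'_attained:
  assumes "x \<in> X"
  obtains y where "y \<in> orb x" "ht y = ht' (orb x)" "\<And>z. z \<in> orb x \<Longrightarrow> ht' (orb x) \<le> ht z"
proof (rule min_height_attained)
  show "orb x \<noteq> {}" using orb_self assms by blast
  show "bdd_below (ht ` orb x)" using orb_bounded assms .
qed (use that in simp)

lemma ht'_le: "\<lbrakk> x \<in> X; y \<in> orb x \<rbrakk> \<Longrightarrow> ht' (orb x) \<le> ht y"
  by (rule ht'_attained[of x]) auto

lemma ht'_minimizer:
  assumes "Y \<in> quotient_set W W' \<phi> X H"
  obtains x where "x \<in> X" "Y = orb x" "ht x = ht' Y"
proof -
  obtain u where u: "u \<in> X" "Y = orb u" using assms unfolding quotient_set_eq by blast
  obtain x where x: "x \<in> orb u" "ht x = ht' (orb u)" using ht'_attained[OF u(1)] .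
  show thesis
  proof (rule that)
    show "x \<in> X" using x(1) orb_subset[OF u(1)] by blast
    show "Y = orb x" using orb_eq[OF x(1) u(1)] u(2) by simp
    show "ht x = ht' Y" using x(2) u(2) by simp
  qed
qed

lemma ht'_translate:
  assumes "x \<in> X"
  obtains h where "h \<in> H" "ht (R h x) = ht' (orb x)"
proof -
  obtain y where "y \<in> orb x" "ht y = ht' (orb x)" using ht'_attained[OF assms] .
  then show thesis using that unfolding orb_def by blast
qed

text \<open>Let \<open>v = k h\<close> be a shortest element of the coset \<open>k H\<close>. Then
  \<open>k x = v (h^-1 x)\<close> with \<open>h^-1 x\<close> in the orbit of \<open>x\<close>, and
  applying \<open>v\<close> changes the height by at most its length.\<close>

lemma ht'_le_coset:
  assumes "x \<in> X" "k \<in> carrier W'"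
  shows "ht' (orb x) \<le> ht (R k x) + min_length W' S' (k <#\<^bsub>W'\<^esub> H)"
proof -
  have "k \<in> k <#\<^bsub>W'\<^esub> H" using W'.lcos_self[OF assms(2) subgroup_H] .
  then obtain v where v: "v \<in> k <#\<^bsub>W'\<^esub> H"
    "min_length W' S' (k <#\<^bsub>W'\<^esub> H) = int (coxeter_length W' S' v)"
    using W'.min_length_attained by blast
  then obtain h where h: "h \<in> H" "v = k \<otimes>\<^bsub>W'\<^esub> h" by (auto simp: l_coset_def)
  note hc = H_closed[OF h(1)]
  obtain ws where ws: "set ws \<subseteq> S'" "word_prod W' ws = v" "length ws = coxeter_length W' S' v"
    using W'.coxeter_length_word h hc assms by (metis W'.m_closed)
  have ih: "inv\<^bsub>W'\<^esub> h \<in> H" using h subgroup_H by (simp add: subgroup.m_inv_closed)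
  let ?x = "R (inv\<^bsub>W'\<^esub> h) x"
  have x: "?x \<in> orb x" "?x \<in> X" using ih assms hc by (auto simp: orb_def)
  have "R v ?x = R (v \<otimes>\<^bsub>W'\<^esub> inv\<^bsub>W'\<^esub> h) x" using h hc assms by (simp add: R_mult)
  also have "v \<otimes>\<^bsub>W'\<^esub> inv\<^bsub>W'\<^esub> h = k" using h hc assms by (simp add: W'.m_assoc)
  finally have vx: "R v ?x = R k x" .
  \<comment> \<open>A word over \<open>S'\<close> becomes a word of the same length over the simple
    reflections of the product, so \<open>ht_word\<close> applies.\<close>
  have "word_prod (W \<times>\<times> W') (map (Pair \<one>\<^bsub>W\<^esub>) us) = (\<one>\<^bsub>W\<^esub>, word_prod W' us)" for us
    by (induction us) auto
  then have "\<bar>ht (R v ?x) - ht ?x\<bar> \<le> int (length ws)"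
    using ht_word[of "map (Pair \<one>\<^bsub>W\<^esub>) ws" ?x] ws x
      prod_simple_subset[OF W.group_axioms W'.group_axioms W.simple_subset W'.simple_subset]
    by (auto simp: prod_simple_def)
  then show ?thesis using ht'_le[OF assms(1) x(1)] ws(3) v(2) vx by simp
qed

text \<open>This is \<open>diag_descent\<close> at the point \<open>(x, H)\<close> of the product of
  \<open>X\<close> with the coset space of \<open>H\<close>, translated back to
  \<open>H\<close>-orbits in \<open>X\<close>.\<close>

lemma orb_descent:
  assumes x: "x \<in> X" and r: "r \<in> reflections W S" and h: "h \<in> H"
    and z: "z \<in> carrier W" "z = \<one>\<^bsub>W\<^esub> \<or> z \<in> S \<and> ht x < ht (L z x)"
    and "ht (L z x) \<le> ht' (orb (L z x))" "ht (L z x) \<le> ht' (orb (L r x))"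
    and "ht (R h (L z (L r x))) \<le> ht x"
  shows "orb (L r x) = orb (L z x)"
proof -
  let ?WW = "W \<times>\<times> W'" and ?SS = "prod_simple W S W' S'"
  let ?D = "?WW \<times>\<times> W'" and ?T = "prod_simple ?WW ?SS W' S'"
  \<comment> \<open>\<open>?i1\<close> lands in the copy of \<open>W'\<close> acting on
    \<open>X\<close>, \<open>?i2\<close> in the copy acting on cosets, and \<open>?j\<close> embeds
    \<open>W\<close>.\<close>
  let ?i1 = "\<lambda>k. ((\<one>\<^bsub>W\<^esub>, k), \<one>\<^bsub>W'\<^esub>)" and ?i2 = "\<lambda>k. ((\<one>\<^bsub>W\<^esub>, \<one>\<^bsub>W'\<^esub>), k)"
    and ?j = "\<lambda>w. ((w, \<one>\<^bsub>W'\<^esub>), \<one>\<^bsub>W'\<^esub>)"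
  let ?Y = "X \<times> (lcosets\<^bsub>W'\<^esub> H)"
  define \<psi> where "\<psi> = (\<lambda>g. \<lambda>p \<in> ?Y. (\<phi> (fst g) (fst p), coset_action W' H (snd g) (snd p)))"
  define F where "F p = ht (fst p) + min_length W' S' (snd p)" for p :: "'x \<times> 'b set"
  have SS: "?SS \<subseteq> carrier ?WW"
    by (rule prod_simple_subset)
      (rule W.group_axioms W'.group_axioms W.simple_subset W'.simple_subset)+
  have groups: "group ?WW" "group ?D"
    by (intro DirProd_group W.group_axioms W'.group_axioms)+
  have T: "?T \<subseteq> carrier ?D"
    using prod_simple_subset[OF groups(1) W'.group_axioms SS W'.simple_subset] .
  have "quasiparabolic_set W' (lcosets\<^bsub>W'\<^esub> H) (coset_action W' H) S' (min_length W' S')"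
    using quasiparabolic_H by (simp add: quasiparabolic_subgroup_def)
  then have "quasiparabolic_set ?D ?Y \<psi> ?T F"
    unfolding \<psi>_def F_def
    using quasiparabolic_set_prod[OF quasiparabolic_set_axioms SS _ W'.simple_subset] by blast
  then interpret P: quasiparabolic_set ?D ?Y \<psi> ?T F .
  interpret P: commuting_copies ?D ?Y \<psi> ?T F W' S' ?i1 ?i2
  proof unfold_locales
    show "?T \<subseteq> carrier ?D" by (rule T)
    show "S' \<subseteq> carrier W'" by (rule W'.simple_subset)
    show "\<And>u. u \<in> S' \<Longrightarrow> u \<otimes>\<^bsub>W'\<^esub> u = \<one>\<^bsub>W'\<^esub>" by (rule W'.simple_square)
    show "?i1 \<in> hom W' ?D" "?i2 \<in> hom W' ?D" by (auto simp: hom_def)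
    show "?i1 ` S' \<subseteq> ?T" "?i2 ` S' \<subseteq> ?T" by (auto simp: prod_simple_def)
  qed auto
  have diag: "P.diag k = ((\<one>\<^bsub>W\<^esub>, k), k)" if "k \<in> carrier W'" for k
    using that by (simp add: P.diag_def)
  note coset = W'.coset_action_self[OF subgroup_H]
  have H_one: "coset_action W' H \<one>\<^bsub>W'\<^esub> H = H"
    using coset(2)[of "\<one>\<^bsub>W'\<^esub>"] W'.lcos_mult_one subgroup.subset[OF subgroup_H] by simp
  have \<psi>_j: "\<psi> (?j w) (u, H) = (L w u, H)" if "u \<in> X" for w u
    using that coset(1) H_one by (simp add: \<psi>_def)
  have \<psi>_diag: "P.act_diag k (u, H) = (R k u, k <#\<^bsub>W'\<^esub> H)" if "k \<in> carrier W'" "u \<in> X" for k u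
    using that coset(1,2) by (simp add: \<psi>_def diag)
  have F_H: "F (u, H) = ht u" for u
    by (simp add: F_def W'.min_length_subgroup[OF subgroup_H])
  \<comment> \<open>The diagonal orbit involves all of \<open>W'\<close>, not only \<open>H\<close>;
    the length of the coset \<open>k H\<close> compensates for leaving \<open>H\<close>.\<close>
  have F_diag: "ht' (orb u) \<le> F (P.act_diag k (u, H))" if "k \<in> carrier W'" "u \<in> X" for k u
    using that ht'_le_coset by (simp add: \<psi>_diag F_def)
  have rc: "r \<in> carrier W" using r W.reflections_closed W.simple_subset by blast
  have jS: "?j ` S \<subseteq> ?T" by (auto simp: prod_simple_def)
  have "?j \<in> hom W ?D" by (auto simp: hom_def)
  then have jr: "?j r \<in> reflections ?D ?T"
    using reflections_hom[OF W.group_axioms groups(2) _ jS W.simple_subset r] by blast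
  obtain ws where ws: "set ws \<subseteq> S'" "word_prod W' ws = h"
    using W'.word_exists H_closed h by blast
  \<comment> \<open>Because \<open>h\<close> fixes the base coset, its diagonal action on
    \<open>(u, H)\<close> adds nothing to the height in the second coordinate.\<close>
  have hH: "h <#\<^bsub>W'\<^esub> H = H"
    using W'.coset_join3[OF H_closed[OF h] subgroup_H h] .
  have "\<exists>k \<in> carrier W'. \<psi> (?j r) (x, H) = P.act_diag k (\<psi> (?j z) (x, H))"
  proof (rule P.diag_descent)
    show "(x, H) \<in> ?Y" using x coset(1) by simp
    show "?j z \<in> carrier ?D" using z by simp
    show "?j z = \<one>\<^bsub>?D\<^esub> \<or> ?j z \<in> ?T \<and> F (x, H) < F (\<psi> (?j z) (x, H))"
      using z(2)
    proof (elim disjE conjE)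
      assume "z = \<one>\<^bsub>W\<^esub>"
      then show ?thesis by (simp only: one_DirProd simp_thms)
    next
      assume "z \<in> S" "ht x < ht (L z x)"
      then show ?thesis using jS unfolding \<psi>_j[OF x] F_H by blast
    qed
    show "?j z \<otimes>\<^bsub>?D\<^esub> ?i1 k = ?i1 k \<otimes>\<^bsub>?D\<^esub> ?j z" "?j z \<otimes>\<^bsub>?D\<^esub> ?i2 k = ?i2 k \<otimes>\<^bsub>?D\<^esub> ?j z"
      if "k \<in> carrier W'" for k
      using that z(1) by (simp_all only: mult_DirProd W.l_one W.r_one W'.l_one W'.r_one
          W.one_closed W'.one_closed)
    show "F (\<psi> (?j z) (x, H)) \<le> F (P.act_diag k (\<psi> (?j z) (x, H)))"
      "F (\<psi> (?j z) (x, H)) \<le> F (P.act_diag k (\<psi> (?j r) (x, H)))" if "k \<in> carrier W'" for k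
      using assms(6,7) F_diag[OF that, of "L z x"] F_diag[OF that, of "L r x"] x z rc
      by (simp_all add: \<psi>_j F_H)
    show "F (P.act_diag (word_prod W' ws) (\<psi> (?j z) (\<psi> (?j r) (x, H)))) \<le> F (x, H)"
      using assms(8) x z rc h H_closed hH by (simp add: ws \<psi>_j \<psi>_diag F_H)
  qed (use ws jr in auto)
  then obtain k where k: "k \<in> carrier W'" "L r x = R k (L z x)" "k <#\<^bsub>W'\<^esub> H = H"
    using x z by (auto simp: \<psi>_j \<psi>_diag)
  \<comment> \<open>Fixing the base coset puts \<open>k\<close> in \<open>H\<close>, so
    \<open>L r x\<close> and \<open>L z x\<close> have the same \<open>H\<close>-orbit.\<close>
  then show ?thesis using orb_R[of k "L z x"] coset(3) x z by simp
qed

section \<open>Quasiparabolicity of the orbit set\<close>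

lemma quotient_action_orb:
  "\<lbrakk> w \<in> carrier W; x \<in> X \<rbrakk> \<Longrightarrow> quotient_action W W' \<phi> X H w (orb x) = orb (L w x)"
  by (simp add: quotient_action_def quotient_set_eq L_orb)

text \<open>If \<open>y\<close> is lowest in the orbit of \<open>x\<close>, then
  \<open>L s y\<close> is a competitor for the minimum over the orbit of
  \<open>L s x\<close>.\<close>

lemma ht'_simple:
  assumes "s \<in> S" "x \<in> X"
  shows "ht' (orb (L s x)) \<le> ht' (orb x) + 1"
proof -
  have "orb x \<in> quotient_set W W' \<phi> X H" using assms by (simp add: quotient_set_eq)
  then obtain y where y: "y \<in> X" "orb x = orb y" "ht y = ht' (orb x)"
    using ht'_minimizer by blast
  have s: "s \<in> carrier W" using assms W.simple_subset by blast
  have "orb (L s y) = orb (L s x)" using L_orb[OF s y(1)] L_orb[OF s assms(2)] y(2) by simp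
  moreover have "ht' (orb (L s y)) \<le> ht (L s y)" using ht'_le orb_self s y(1) by simp
  ultimately have "ht' (orb (L s x)) \<le> ht (L s y)" by simp
  also have "\<dots> \<le> ht y + 1"
    using ht_simple[of "(s, \<one>\<^bsub>W'\<^esub>)" y] assms y by (auto simp: prod_simple_def)
  finally show ?thesis using y by simp
qed

lemma ht'_simple_abs:
  assumes "s \<in> S" "x \<in> X"
  shows "\<bar>ht' (orb (L s x)) - ht' (orb x)\<bar> \<le> 1"
proof -
  have s: "s \<in> carrier W" using assms W.simple_subset by blast
  then have "L s (L s x) = x"
    using assms W.simple_square by (simp flip: L_mult)
  then show ?thesis using ht'_simple[OF assms] ht'_simple[of s "L s x"] assms s by simp
qed

lemma quasiparabolic_quotient:
  "quasiparabolic_set W (quotient_set W W' \<phi> X H) (quotient_action W W' \<phi> X H) S ht'"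
proof -
  let ?Q = "quotient_set W W' \<phi> X H" and ?act = "quotient_action W W' \<phi> X H"
  have "group_action W ?Q ?act"
  proof (rule group_actionI)
    show "group W" by (rule W.group_axioms)
    show "?act w \<in> extensional ?Q" for w by (simp add: quotient_action_def)
  qed (auto simp: quotient_set_eq quotient_action_orb L_mult)
  then interpret A: group_action W ?Q ?act .
  show ?thesis
  proof unfold_locales
    fix s Y assume "s \<in> S" "Y \<in> ?Q"
    then show "\<bar>ht' (?act s Y) - ht' Y\<bar> \<le> 1"
      using W.simple_subset ht'_simple_abs by (auto simp: quotient_set_eq quotient_action_orb)
  next
    fix r Y assume r: "r \<in> reflections W S" and Y: "Y \<in> ?Q" and eq: "ht' (?act r Y) = ht' Y"
    have rc: "r \<in> carrier W" using r W.reflections_closed W.simple_subset by blast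
    obtain x where x: "x \<in> X" "Y = orb x" "ht x = ht' Y" using ht'_minimizer[OF Y] .
    obtain h where h: "h \<in> H" "ht (R h (L r x)) = ht' (orb (L r x))"
      using ht'_translate[of "L r x"] x rc by auto
    \<comment> \<open>With \<open>z = \<one>\<close>, the equality of the two minima gives the lower
      bound on the orbit of \<open>L r x\<close> and, through \<open>h\<close>, the required upper
      bound.\<close>
    have "orb (L r x) = orb (L \<one>\<^bsub>W\<^esub> x)"
      by (rule orb_descent[OF x(1) r h(1)]) (use x eq rc h in \<open>simp_all add: quotient_action_orb\<close>)
    then show "?act r Y = Y" using x rc by (simp add: quotient_action_orb)
  next
    fix r Y s assume r: "r \<in> reflections W S" and Y: "Y \<in> ?Q" and s: "s \<in> S"
      and up: "ht' Y < ht' (?act r Y)" and down: "ht' (?act s (?act r Y)) < ht' (?act s Y)"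
    have rc: "r \<in> carrier W" "s \<in> carrier W"
      using r s W.reflections_closed W.simple_subset by blast+
    obtain x where x: "x \<in> X" "Y = orb x" "ht x = ht' Y" using ht'_minimizer[OF Y] .
    let ?m = "ht' (orb x)"
    have "?m < ht' (orb (L r x))" "ht' (orb (L s (L r x))) < ht' (orb (L s x))"
      using up down x rc by (simp_all add: quotient_action_orb)
    \<comment> \<open>The heights are integers and \<open>s\<close> changes them by at most one, so
      the two strict inequalities determine all three values.\<close>
    then have m: "ht' (orb (L r x)) = ?m + 1" "ht' (orb (L s x)) = ?m + 1"
        "ht' (orb (L s (L r x))) = ?m"
      using ht'_simple_abs[OF s x(1)] ht'_simple_abs[OF s, of "L r x"] x rc by auto
    \<comment> \<open>The upper bound \<open>?m + 1\<close> meets the minimum over the orbit, so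
      \<open>L s x\<close> is itself lowest in its orbit.\<close>
    have "ht (L s x) \<le> ht x + 1"
      using ht_simple[of "(s, \<one>\<^bsub>W'\<^esub>)" x] s x by (auto simp: prod_simple_def)
    moreover have "ht' (orb (L s x)) \<le> ht (L s x)" using ht'_le orb_self x rc by simp
    ultimately have sx: "ht (L s x) = ?m + 1" using m x by simp
    obtain h where h: "h \<in> H" "ht (R h (L s (L r x))) = ht' (orb (L s (L r x)))"
      using ht'_translate[of "L s (L r x)"] x rc by auto
    \<comment> \<open>Now \<open>z = s\<close> raises \<open>x\<close>, and \<open>h\<close> brings
      \<open>L s (L r x)\<close> back down to the height of \<open>x\<close>.\<close>
    have "orb (L r x) = orb (L s x)"
      by (rule orb_descent[OF x(1) r h(1)]) (use x m sx s rc h in simp_all)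
    then show "?act r Y = ?act s Y" using x rc by (simp add: quotient_action_orb)
  qed
qed

end

theorem theorem3p6:
  fixes W :: "('a, 'c) monoid_scheme" and S :: "'a set"
    and W' :: "('b, 'd) monoid_scheme" and S' :: "'b set"
    and X :: "'x set" and \<phi> :: "'a \<times> 'b \<Rightarrow> 'x \<Rightarrow> 'x" and ht :: "'x \<Rightarrow> int"
    and H :: "'b set"
  assumes "coxeter_system W S"
    and "coxeter_system W' S'"
    and "quasiparabolic_set (W \<times>\<times> W') X \<phi> (prod_simple W S W' S') ht"
    and "quasiparabolic_subgroup W' S' H"
    and "\<And>Y. Y \<in> quotient_set W W' \<phi> X H \<Longrightarrow> bdd_below (ht ` Y)"
  shows "quasiparabolic_set W (quotient_set W W' \<phi> X H) (quotient_action W W' \<phi> X H) S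
    (min_height ht)"
proof -
  interpret quasiparabolic_quotient W S W' S' X \<phi> ht H
    by (intro quasiparabolic_quotient.intro quasiparabolic_quotient_axioms.intro assms)
  show ?thesis by (rule quasiparabolic_quotient)
qed

end
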